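(* Let $(N,(A_i)_{i\in N},(u_i)_{i\in N})$ be a finite strategic game with player set $N=\{1,\dots,n\}$, with pure-payoff region $S_{\mathrm{pu}}$ and noncooperative payoff region $S_{\mathrm{nc}}$ in $\mathbb{R}^n$. Let $\alpha_1,\dots,\alpha_n\in\mathbb{R}$ and let $W\colon S_{\mathrm{nc}}\to\mathbb{R}$ be the weighted utilitarian social welfare function $W(v)=\sum_{i\in N}\alpha_i v_i$. Then $W$ attains its maximum over $S_{\mathrm{nc}}$ at a payoff vector generated by a pure-strategy profile, i.e. $$\max\{W(v)\mid v\in S_{\mathrm{nc}}\}=\max\{W(v)\mid v\in S_{\mathrm{pu}}\}.$$
   Context: A finite strategic game $(N,(A_i)_{i\in N},(u_i)_{i\in N})$ consists of a player set $N=\{1,\dots,n\}$, for each $i\in N$ a nonempty finite set $A_i$ of pure strategies, and payoff functions $u_i\colon\prod_{j\in N}A_j\to\mathbb{R}$; put $u=(u_1,\dots,u_n)\colon\prod_{j\in N}A_j\to\mathbb{R}^n$. For a nonempty finite set $X$, $\Delta(X)$ is the set of probability distributions on $X$. For a mixed-strategy profile $\sigma=(\sigma_1,\dots,\sigma_n)\in\prod_{i\in N}\Delta(A_i)$ set $u(\sigma)=\sum_{a\in\prod_{i\in N}A_i}\big(\prod_{i\in N}\sigma_i(a_i)\big)u(a)$. The pure-payoff region is $S_{\mathrm{pu}}=u(\prod_{i\in N}A_i)$ and the noncooperative payoff region is $S_{\mathrm{nc}}=u(\prod_{i\in N}\Delta(A_i))$; one has $S_{\mathrm{pu}}\subseteq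 S_{\mathrm{nc}}$. *)

theory Defs
  imports "HOL-Probability.Probability"
begin

(* A game has the finite type 'n as its player set; A i is player i's set of pure strategies,
   and u i is player i's payoff function. All the sets A i live in one type 'a (up to renaming
   of strategies, this is no restriction). *)

definition pure_profiles :: "('n \<Rightarrow> 'a set) \<Rightarrow> ('n \<Rightarrow> 'a) set"
  where "pure_profiles A = (\<Pi>\<^sub>E i\<in>UNIV. A i)"

definition distributions_on :: "'a set \<Rightarrow> 'a pmf set"
  where "distributions_on X = {p. set_pmf p \<subseteq> X}"

definition mixed_profiles :: "('n \<Rightarrow> 'a set) \<Rightarrow> ('n \<Rightarrow> 'a pmf) set"
  where "mixed_profiles A = (\<Pi>\<^sub>E i\<in>UNIV. distributions_on (A i))"

definition payoff_vector :: "('n::finite \<Rightarrow> ('n \<Rightarrow> 'a) \<Rightarrow> real) \<Rightarrow> ('n \<Rightarrow> 'a) \<Rightarrow> real ^ 'n"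
  where "payoff_vector u a = (\<chi> i. u i a)"

definition mixed_payoff ::
  "('n::finite \<Rightarrow> 'a set) \<Rightarrow> ('n \<Rightarrow> ('n \<Rightarrow> 'a) \<Rightarrow> real) \<Rightarrow> ('n \<Rightarrow> 'a pmf) \<Rightarrow> real ^ 'n"
  where "mixed_payoff A u \<sigma> =
    (\<Sum>a\<in>pure_profiles A. (\<Prod>i\<in>UNIV. pmf (\<sigma> i) (a i)) *\<^sub>R payoff_vector u a)"

definition S_pu :: "('n::finite \<Rightarrow> 'a set) \<Rightarrow> ('n \<Rightarrow> ('n \<Rightarrow> 'a) \<Rightarrow> real) \<Rightarrow> (real ^ 'n) set"
  where "S_pu A u = payoff_vector u ` pure_profiles A"

definition S_nc :: "('n::finite \<Rightarrow> 'a set) \<Rightarrow> ('n \<Rightarrow> ('n \<Rightarrow> 'a) \<Rightarrow> real) \<Rightarrow> (real ^ 'n) set"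
  where "S_nc A u = mixed_payoff A u ` mixed_profiles A"

definition utilitarian_welfare :: "('n::finite \<Rightarrow> real) \<Rightarrow> real ^ 'n \<Rightarrow> real"
  where "utilitarian_welfare \<alpha> v = (\<Sum>i\<in>UNIV. \<alpha> i * v $ i)"

end

(* Welfare is linear in the payoff vector, so the welfare of a mixed profile is the average of the
   welfare of the pure profiles under the product distribution, and an average is at most the
   largest averaged value. *)

theory Submission
  imports Defs
begin

lemma finite_pure_profiles:
  fixes A :: "'n::finite \<Rightarrow> 'a set"
  assumes "\<And>i. finite (A i)"
  shows "finite (pure_profiles A)"
  unfolding pure_profiles_def using assms by (intro finite_PiE) auto

lemma mixed_profiles_iff: "\<sigma> \<in> mixed_profiles A \<longleftrightarrow> (\<forall>i. set_pmf (\<sigma> i) \<subseteq> A i)"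
  by (auto simp: mixed_profiles_def distributions_on_def PiE_iff)

text \<open>Distributivity turns the sum over profiles into a product of the players' total masses,
  and each mass is 1 because \<open>A i\<close> is finite and contains the support of
  \<open>\<sigma> i\<close>.\<close>

lemma sum_prod_pmf_pure_profiles:
  fixes A :: "'n::finite \<Rightarrow> 'a set"
  assumes "\<And>i. finite (A i)" and "\<sigma> \<in> mixed_profiles A"
  shows "(\<Sum>a\<in>pure_profiles A. \<Prod>i\<in>UNIV. pmf (\<sigma> i) (a i)) = 1"
proof -
  have "(\<Sum>a\<in>pure_profiles A. \<Prod>i\<in>UNIV. pmf (\<sigma> i) (a i)) = (\<Prod>i\<in>UNIV. \<Sum>x\<in>A i. pmf (\<sigma> i) x)"
    unfolding pure_profiles_def using assms(1) by (intro prod_sum_PiE [symmetric]) auto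
  also have "\<dots> = 1"
    using assms by (intro prod.neutral ballI sum_pmf_eq_1) (auto simp: mixed_profiles_iff)
  finally show ?thesis .
qed

text \<open>The product of point masses is the point mass at \<open>b\<close>, so only the summand
  of \<open>b\<close> survives. This embeds pure play into mixed play.\<close>

lemma mixed_payoff_return_pmf:
  fixes A :: "'n::finite \<Rightarrow> 'a set"
  assumes "\<And>i. finite (A i)" and "b \<in> pure_profiles A"
  shows "mixed_payoff A u (\<lambda>i. return_pmf (b i)) = payoff_vector u b"
proof -
  \<comment> \<open>All factors are 0 or 1, and a profile other than \<open>b\<close> differs from
    it in some coordinate, which contributes a factor 0.\<close>
  have "(\<Prod>i\<in>UNIV. pmf (return_pmf (b i)) (a i)) = of_bool (a = b)" for a
    by (auto simp: fun_eq_iff indicator_def) metis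
  then show ?thesis
    using assms(2) finite_pure_profiles [of A, OF assms(1)]
    by (simp add: mixed_payoff_def of_bool_def if_distrib [where f = "\<lambda>x. x *\<^sub>R _"] cong: if_cong)
qed

lemma S_pu_subset_S_nc:
  fixes A :: "'n::finite \<Rightarrow> 'a set"
  assumes "\<And>i. finite (A i)"
  shows "S_pu A u \<subseteq> S_nc A u"
proof
  fix v assume "v \<in> S_pu A u"
  then obtain b where b: "b \<in> pure_profiles A" "v = payoff_vector u b"
    by (auto simp: S_pu_def)
  then have "(\<lambda>i. return_pmf (b i)) \<in> mixed_profiles A"
    by (auto simp: mixed_profiles_iff pure_profiles_def)
  then show "v \<in> S_nc A u"
    using mixed_payoff_return_pmf [OF assms b(1), of u] b(2) unfolding S_nc_def by (metis imageI)
qed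

text \<open>Linearity of welfare, obtained by exchanging the sum over players with the sum over
  \<open>X\<close>. In the application, \<open>c\<close> gives the probabilities of the pure
  profiles.\<close>

lemma utilitarian_welfare_sum:
  "utilitarian_welfare \<alpha> (\<Sum>a\<in>X. c a *\<^sub>R f a) = (\<Sum>a\<in>X. c a * utilitarian_welfare \<alpha> (f a))"
proof -
  have "utilitarian_welfare \<alpha> (\<Sum>a\<in>X. c a *\<^sub>R f a) = (\<Sum>i\<in>UNIV. \<Sum>a\<in>X. c a * (\<alpha> i * f a $ i))"
    by (simp add: utilitarian_welfare_def sum_distrib_left mult.left_commute)
  also have "\<dots> = (\<Sum>a\<in>X. \<Sum>i\<in>UNIV. c a * (\<alpha> i * f a $ i))"
    by (rule sum.swap)
  finally show ?thesis
    by (simp add: utilitarian_welfare_def sum_distrib_left)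
qed

text \<open>The weights are nonnegative, so each pure welfare may be replaced by \<open>m\<close>;
  they sum to 1, so the resulting average is \<open>m\<close>.\<close>

lemma utilitarian_welfare_mixed_le:
  fixes A :: "'n::finite \<Rightarrow> 'a set"
  assumes "\<And>i. finite (A i)" and "\<sigma> \<in> mixed_profiles A"
    and le: "\<And>a. a \<in> pure_profiles A \<Longrightarrow> utilitarian_welfare \<alpha> (payoff_vector u a) \<le> m"
  shows "utilitarian_welfare \<alpha> (mixed_payoff A u \<sigma>) \<le> m"
proof -
  have "utilitarian_welfare \<alpha> (mixed_payoff A u \<sigma>)
      \<le> (\<Sum>a\<in>pure_profiles A. (\<Prod>i\<in>UNIV. pmf (\<sigma> i) (a i)) * m)"
    unfolding mixed_payoff_def utilitarian_welfare_sum
    by (intro sum_mono mult_left_mono le prod_nonneg) auto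
  then show ?thesis
    using sum_prod_pmf_pure_profiles [OF assms(1,2)] by (simp flip: sum_distrib_right)
qed

text \<open>\<open>GREATEST\<close> is a definite description, informative only where a maximum
  exists; the common maximiser \<open>v\<close> in the first conjunct supplies that existence for
  both regions.\<close>

theorem mainTheorem7:
  fixes A :: "'n::finite \<Rightarrow> 'a set"
    and u :: "'n \<Rightarrow> ('n \<Rightarrow> 'a) \<Rightarrow> real"
    and \<alpha> :: "'n \<Rightarrow> real"
  assumes "\<And>i. finite (A i)"
    and "\<And>i. A i \<noteq> {}"
  shows "(\<exists>v. is_arg_max (utilitarian_welfare \<alpha>) (\<lambda>w. w \<in> S_nc A u) v
            \<and> is_arg_max (utilitarian_welfare \<alpha>) (\<lambda>w. w \<in> S_pu A u) v)
       \<and> (GREATEST r. r \<in> {utilitarian_welfare \<alpha> v | v. v \<in> S_nc A u})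
           = (GREATEST r. r \<in> {utilitarian_welfare \<alpha> v | v. v \<in> S_pu A u})"
proof -
  let ?W = "utilitarian_welfare \<alpha>"
  have "finite (S_pu A u)"
    unfolding S_pu_def using finite_pure_profiles assms(1) by (intro finite_imageI) blast
  moreover have "S_pu A u \<noteq> {}"
    using assms(2) by (simp add: S_pu_def pure_profiles_def PiE_eq_empty_iff)
  \<comment> \<open>The maximiser is picked among the finitely many pure payoffs, so no compactness
    argument for \<open>S_nc A u\<close> is needed.\<close>
  ultimately obtain v where v: "v \<in> S_pu A u" and max: "\<And>w. w \<in> S_pu A u \<Longrightarrow> ?W w \<le> ?W v"
    using Max_in [of "?W ` S_pu A u"] Max_ge [of "?W ` S_pu A u"] by fastforce
  have v': "v \<in> S_nc A u"
    using S_pu_subset_S_nc assms(1) v by blast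
  \<comment> \<open>The averaging bound is applied with \<open>m\<close> equal to
    \<open>?W v\<close>.\<close>
  have max': "?W w \<le> ?W v" if w: "w \<in> S_nc A u" for w
  proof -
    from w obtain \<sigma> where "\<sigma> \<in> mixed_profiles A" "w = mixed_payoff A u \<sigma>"
      by (auto simp: S_nc_def)
    then show ?thesis
      using assms(1) max by (auto simp: S_pu_def intro!: utilitarian_welfare_mixed_le)
  qed
  have "(GREATEST r. r \<in> {?W w | w. w \<in> S_nc A u}) = ?W v"
    using v' max' by (intro Greatest_equality) auto
  moreover have "(GREATEST r. r \<in> {?W w | w. w \<in> S_pu A u}) = ?W v"
    using v max by (intro Greatest_equality) auto
  moreover have "is_arg_max ?W (\<lambda>w. w \<in> S_nc A u) v" "is_arg_max ?W (\<lambda>w. w \<in> S_pu A u) v"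
    using v v' max max' by (auto simp: is_arg_max_linorder)
  ultimately show ?thesis by auto
qed

end
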